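(* Let $\breve{\mathcal T}\in\mathbb Q^{n_1\times n_2\times m}$ be any third-order quaternion tensor. Then there exist unitary quaternion tensors $\breve{\mathcal U}\in\mathbb Q^{n_1\times n_1\times m}$ and $\breve{\mathcal V}\in\mathbb Q^{n_2\times n_2\times m}$ and a diagonal quaternion tensor $\breve{\mathcal S}\in\mathbb Q^{n_1\times n_2\times m}$ such that $$\breve{\mathcal T}=\breve{\mathcal U}\star\breve{\mathcal S}\star\breve{\mathcal V}^*.$$
   Context: $\mathbb Q$ denotes the real quaternion algebra. For a tensor $\mathcal T$ of size $n_1\times n_2\times m$, the frontal slices are $\mathbf T_t=\mathcal T(:,:,t)$, $t=1,\dots,m$. $\mathrm{unfold}(\mathcal T)$ is the $n_1m\times n_2$ matrix obtained by stacking $\mathbf T_1,\dots,\mathbf T_m$ vertically, and $\mathrm{fold}$ is its inverse. $\mathrm{bcirc}(\mathcal T)$ is the $n_1m\times n_2m$ block circulant matrix whose $(a,b)$ block ($a,b=1,\dots,m$) is $\mathbf T_{((a-b)\bmod m)+1}$. The $t$-product of $\mathcal T\in\mathbb Q^{n_1\times n_2\times m}$ and $\mathcal B\in\mathbb Q^{n_2\times n_3\times m}$ is the $n_1\times n_3\times m$ tensor $\mathcal T\star\mathcal B=\mathrm{fold}(\mathrm{bcirc}(\mathcal T)\,\mathrm{unfold}(\mathcal B))$. The identity tensor $\mathcal I$ of size $n\times n\times m$ has first frontal slice the $n\times n$ identity matrix and all other frontal slices zero. The conjugate transpose $\mathcal B^*$ of an $n_1\times n_2\times m$ tensor $\mathcal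 B$ is the $n_2\times n_1\times m$ tensor obtained by (quaternion) conjugate transposing each frontal slice and then reversing the order of the transposed frontal slices $2$ through $m$. A tensor $\mathcal Q$ of size $n\times n\times m$ is unitary if $\mathcal Q^*\star\mathcal Q=\mathcal Q\star\mathcal Q^*=\mathcal I$. A tensor is diagonal if each of its frontal slices is a diagonal (possibly rectangular) matrix, i.e. has zero $(s,p)$ entry whenever $s\ne p$. *)

theory Defs
  imports "HOL-Analysis.Analysis" "Jordan_Normal_Form.Matrix"
begin

section \<open>The real quaternion algebra\<close>

text \<open>\<open>Quat a b c d\<close> is the quaternion \<open>a + b i + c j + d k\<close>.\<close>

datatype quat = Quat (qre: real) (qim1: real) (qim2: real) (qim3: real)

lemma quat_eq_iff:
  "x = y \<longleftrightarrow> qre x = qre y \<and> qim1 x = qim1 y \<and> qim2 x = qim2 y \<and> qim3 x = qim3 y"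
  by (auto intro: quat.expand)

instantiation quat :: real_algebra_1
begin

definition zero_quat :: quat where "0 = Quat 0 0 0 0"

definition one_quat :: quat where "1 = Quat 1 0 0 0"

definition plus_quat :: "quat \<Rightarrow> quat \<Rightarrow> quat" where
  "x + y = Quat (qre x + qre y) (qim1 x + qim1 y) (qim2 x + qim2 y) (qim3 x + qim3 y)"

definition uminus_quat :: "quat \<Rightarrow> quat" where
  "- x = Quat (- qre x) (- qim1 x) (- qim2 x) (- qim3 x)"

definition minus_quat :: "quat \<Rightarrow> quat \<Rightarrow> quat" where
  "x - y = Quat (qre x - qre y) (qim1 x - qim1 y) (qim2 x - qim2 y) (qim3 x - qim3 y)"

definition times_quat :: "quat \<Rightarrow> quat \<Rightarrow> quat" where
  "x * y = Quat
     (qre x * qre y - qim1 x * qim1 y - qim2 x * qim2 y - qim3 x * qim3 y)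
     (qre x * qim1 y + qim1 x * qre y + qim2 x * qim3 y - qim3 x * qim2 y)
     (qre x * qim2 y - qim1 x * qim3 y + qim2 x * qre y + qim3 x * qim1 y)
     (qre x * qim3 y + qim1 x * qim2 y - qim2 x * qim1 y + qim3 x * qre y)"

definition scaleR_quat :: "real \<Rightarrow> quat \<Rightarrow> quat" where
  "scaleR r x = Quat (r * qre x) (r * qim1 x) (r * qim2 x) (r * qim3 x)"

instance
  by standard
    (auto simp: quat_eq_iff zero_quat_def one_quat_def plus_quat_def uminus_quat_def
      minus_quat_def times_quat_def scaleR_quat_def algebra_simps)

end

definition qcnj :: "quat \<Rightarrow> quat" where
  "qcnj x = Quat (qre x) (- qim1 x) (- qim2 x) (- qim3 x)"

definition quat_i :: quat where "quat_i = Quat 0 1 0 0"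
definition quat_j :: quat where "quat_j = Quat 0 0 1 0"
definition quat_k :: quat where "quat_k = Quat 0 0 0 1"

lemma quat_unit_relations:
  "quat_i * quat_i = - 1" "quat_j * quat_j = - 1" "quat_k * quat_k = - 1"
  "quat_i * quat_j = quat_k" "quat_j * quat_k = quat_i" "quat_k * quat_i = quat_j"
  "quat_j * quat_i = - quat_k" "quat_k * quat_j = - quat_i" "quat_i * quat_k = - quat_j"
  by (simp_all add: quat_i_def quat_j_def quat_k_def times_quat_def uminus_quat_def one_quat_def)

lemma qcnj_mult: "qcnj (x * y) = qcnj y * qcnj x"
  by (simp add: qcnj_def times_quat_def algebra_simps)


section \<open>Third-order tensors and the t-product\<close>

text \<open>
  A tensor is the list of its frontal slices. Lists and matrix entries are indexed from \<open>0\<close>,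
  so \<open>T ! t\<close> is the frontal slice that is customarily numbered \<open>t + 1\<close>.
\<close>

type_synonym 'a tensor = "'a mat list"

definition carrier_tensor :: "nat \<Rightarrow> nat \<Rightarrow> nat \<Rightarrow> 'a tensor set" where
  "carrier_tensor n1 n2 m = {T. length T = m \<and> (\<forall>t<m. T ! t \<in> carrier_mat n1 n2)}"

text \<open>
  All slices of a tensor have the same size, so the size is read off the first slice. For
  \<open>m = 0\<close> these two numbers are unspecified, but then they affect no entry of the product below.
\<close>

definition tdim_row :: "'a tensor \<Rightarrow> nat" where "tdim_row T = dim_row (hd T)"
definition tdim_col :: "'a tensor \<Rightarrow> nat" where "tdim_col T = dim_col (hd T)"

definition tunfold :: "'a tensor \<Rightarrow> 'a mat" where
  "tunfold T = (let n1 = tdim_row T; n2 = tdim_col T in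
     mat (n1 * length T) n2 (\<lambda>(i, j). T ! (i div n1) $$ (i mod n1, j)))"

definition tfold :: "nat \<Rightarrow> nat \<Rightarrow> 'a mat \<Rightarrow> 'a tensor" where
  "tfold n1 m M =
     map (\<lambda>t. mat n1 (dim_col M) (\<lambda>(i, j). M $$ (t * n1 + i, j))) [0..<m]"

text \<open>
  The zero-based block \<open>(a, b)\<close> is slice \<open>(a - b) mod m\<close>; adding \<open>m\<close> avoids truncated subtraction.
\<close>

definition bcirc :: "'a tensor \<Rightarrow> 'a mat" where
  "bcirc T = (let n1 = tdim_row T; n2 = tdim_col T; m = length T in
     mat (n1 * m) (n2 * m)
       (\<lambda>(i, j). T ! ((i div n1 + m - j div n2) mod m) $$ (i mod n1, j mod n2)))"

definition tprod :: "'a::semiring_0 tensor \<Rightarrow> 'a tensor \<Rightarrow> 'a tensor" (infixl \<open>\<star>\<close> 70) where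
  "T \<star> B = tfold (tdim_row T) (length T) (bcirc T * tunfold B)"

definition tident :: "nat \<Rightarrow> nat \<Rightarrow> 'a::{zero,one} tensor" where
  "tident n m = map (\<lambda>t. if t = 0 then 1\<^sub>m n else 0\<^sub>m n n) [0..<m]"

definition qmat_adjoint :: "quat mat \<Rightarrow> quat mat" where
  "qmat_adjoint A = map_mat qcnj (transpose_mat A)"

fun tadjoint :: "quat tensor \<Rightarrow> quat tensor" where
  "tadjoint [] = []"
| "tadjoint (A # As) = qmat_adjoint A # rev (map qmat_adjoint As)"

definition tunitary :: "nat \<Rightarrow> nat \<Rightarrow> quat tensor \<Rightarrow> bool" where
  "tunitary n m Q \<longleftrightarrow> Q \<in> carrier_tensor n n m \<and>
     tadjoint Q \<star> Q = tident n m \<and> Q \<star> tadjoint Q = tident n m"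

definition tdiagonal :: "'a::zero tensor \<Rightarrow> bool" where
  "tdiagonal S \<longleftrightarrow> (\<forall>t<length S. diagonal_mat (S ! t))"

lemma tfold_tunfold:
  assumes T: "T \<in> carrier_tensor n1 n2 m"
  shows "tfold n1 m (tunfold T) = T"
proof (rule nth_equalityI)
  show "length (tfold n1 m (tunfold T)) = length T"
    using T by (simp add: tfold_def carrier_tensor_def)
  fix t assume "t < length (tfold n1 m (tunfold T))"
  then have t: "t < m" by (simp add: tfold_def)
  have len: "length T = m" and Tt: "T ! t \<in> carrier_mat n1 n2" and T0: "T ! 0 \<in> carrier_mat n1 n2"
    using T t by (auto simp: carrier_tensor_def)
  have hd: "hd T = T ! 0" using len t by (intro hd_conv_nth) auto
  have dims: "tdim_row T = n1" "tdim_col T = n2"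
    using T0 by (auto simp: tdim_row_def tdim_col_def hd)
  have bound: "t * n1 + i < n1 * m" if "i < n1" for i
  proof -
    have "t * n1 + i < Suc t * n1" using that by simp
    also have "\<dots> \<le> m * n1" using t by (intro mult_le_mono1) simp
    finally show ?thesis by (simp add: mult.commute)
  qed
  show "tfold n1 m (tunfold T) ! t = T ! t"
    using Tt t bound by (intro eq_matI) (auto simp: tfold_def tunfold_def dims len Let_def)
qed

end

theory Submission
  imports Defs
begin

text \<open>
  Choose unitary \<open>U\<close>, \<open>V\<close> maximising \<open>\<Sum>\<^sub>s e(s) Re S(0)\<^sub>s\<^sub>s\<close>, where \<open>S = U\<^sup>* \<star> T \<star> V\<close>, the index \<open>0\<close> is
  the first frontal slice and the weights \<open>e(s)\<close> are positive and distinct; the maximum exists because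
  the unitary tensors form a compact set. Rotating two rows \<open>s\<close>, \<open>p\<close> of \<open>S\<close> against each other, with
  a unit quaternion and a cyclic shift \<open>w\<close> of the slices as phase, cannot increase the functional,
  hence \<open>e(s) S(-w)\<^sub>p\<^sub>s = e(p) cnj (S(w)\<^sub>s\<^sub>p)\<close>. Column rotations give the same relation with \<open>e(s)\<close> and
  \<open>e(p)\<close> exchanged, and both together force \<open>S(w)\<^sub>s\<^sub>p = 0\<close>.
\<close>

section \<open>Quaternion coordinates and sums over residues modulo \<open>m\<close>\<close>

lemma quat_components [simp]:
  "qre 0 = 0" "qim1 0 = 0" "qim2 0 = 0" "qim3 0 = 0"
  "qre 1 = 1" "qim1 1 = 0" "qim2 1 = 0" "qim3 1 = 0"
  "qre (x + y) = qre x + qre y" "qim1 (x + y) = qim1 x + qim1 y"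
  "qim2 (x + y) = qim2 x + qim2 y" "qim3 (x + y) = qim3 x + qim3 y"
  "qre (- x) = - qre x" "qim1 (- x) = - qim1 x" "qim2 (- x) = - qim2 x" "qim3 (- x) = - qim3 x"
  "qre (x - y) = qre x - qre y"
  "qre (r *\<^sub>R x) = r * qre x" "qim1 (r *\<^sub>R x) = r * qim1 x"
  "qim2 (r *\<^sub>R x) = r * qim2 x" "qim3 (r *\<^sub>R x) = r * qim3 x"
  by (simp_all add: zero_quat_def one_quat_def plus_quat_def uminus_quat_def minus_quat_def
      scaleR_quat_def)

lemma qcnj_components [simp]:
  "qre (qcnj x) = qre x" "qim1 (qcnj x) = - qim1 x"
  "qim2 (qcnj x) = - qim2 x" "qim3 (qcnj x) = - qim3 x"
  by (simp_all add: qcnj_def)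

lemma qcnj_simps [simp]:
  "qcnj 0 = 0" "qcnj 1 = 1" "qcnj (qcnj x) = x" "qcnj (x + y) = qcnj x + qcnj y"
  "qcnj (r *\<^sub>R x) = r *\<^sub>R qcnj x"
  by (simp_all add: quat_eq_iff)

lemma qcnj_sum: "qcnj (sum f A) = (\<Sum>x\<in>A. qcnj (f x))"
  by (induction A rule: infinite_finite_induct) auto

lemma qre_sum: "qre (sum f A) = (\<Sum>x\<in>A. qre (f x))"
  by (induction A rule: infinite_finite_induct) auto

lemma qre_qcnj_mult_self:
  "qre (qcnj x * x) = (qre x)\<^sup>2 + (qim1 x)\<^sup>2 + (qim2 x)\<^sup>2 + (qim3 x)\<^sup>2"
  by (simp add: times_quat_def power2_eq_square)

text \<open>Exactly one \<open>u\<close> in the range is congruent to \<open>z\<close>. A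
  convolution with a factor supported on a single slice collapses this way.\<close>

lemma sum_over_residue:
  fixes f :: "int \<Rightarrow> 'a::comm_monoid_add"
  assumes "m > 0"
  shows "(\<Sum>u\<in>{0..<int m}. if int m dvd z - u then f u else 0) = f (z mod int m)"
proof -
  have "int m dvd z - u \<longleftrightarrow> u = z mod int m" if "u \<in> {0..<int m}" for u
    using that by (auto simp flip: mod_eq_dvd_iff)
  then have "(\<Sum>u\<in>{0..<int m}. if int m dvd z - u then f u else 0)
      = (\<Sum>u\<in>{0..<int m}. if u = z mod int m then f u else 0)"
    by (intro sum.cong) auto
  also have "\<dots> = f (z mod int m)"
    using assms by simp
  finally show ?thesis .
qed

text \<open>Translation permutes the residue classes modulo \<open>m\<close>; this is the change of
  variable for cyclic convolutions.\<close>

lemma sum_periodic_shift: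
  fixes f :: "int \<Rightarrow> 'a::comm_monoid_add"
  assumes "m > 0" and "\<And>u. f (u mod int m) = f u"
  shows "(\<Sum>u\<in>{0..<int m}. f (u + c)) = (\<Sum>u\<in>{0..<int m}. f u)"
proof (rule sum.reindex_bij_witness[where i = "\<lambda>u. (u - c) mod int m" and j = "\<lambda>u. (u + c) mod int m"])
qed (use assms in \<open>auto simp: mod_simps\<close>)

subsection \<open>Tensor entries as periodic functions\<close>

text \<open>Indexing the slices by all integers, read modulo their number, treats tensors as
  matrices over the group ring of a cyclic group: block indices of \<open>bcirc\<close> become plain
  differences and the slice reversal in \<open>tadjoint\<close> becomes negation.\<close>

definition tent :: "'a tensor \<Rightarrow> int \<Rightarrow> nat \<Rightarrow> nat \<Rightarrow> 'a" where
  "tent A z i j = A ! nat (z mod int (length A)) $$ (i, j)"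

definition tens :: "nat \<Rightarrow> nat \<Rightarrow> nat \<Rightarrow> (int \<Rightarrow> nat \<Rightarrow> nat \<Rightarrow> 'a) \<Rightarrow> 'a tensor" where
  "tens n1 n2 m f = map (\<lambda>t. mat n1 n2 (\<lambda>(i, j). f (int t) i j)) [0..<m]"

lemma tens_carrier [simp]: "tens n1 n2 m f \<in> carrier_tensor n1 n2 m"
  by (simp add: tens_def carrier_tensor_def)

lemma tent_tens:
  assumes "m > 0" "i < n1" "j < n2"
  shows "tent (tens n1 n2 m f) z i j = f (z mod int m) i j"
  using assms by (simp add: tent_def tens_def nat_less_iff)

lemma tent_mod:
  assumes "A \<in> carrier_tensor n1 n2 m"
  shows "tent A (z mod int m) i j = tent A z i j"
  using assms by (simp add: tent_def carrier_tensor_def)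

lemma tent_cong:
  assumes "A \<in> carrier_tensor n1 n2 m" "z mod int m = z' mod int m"
  shows "tent A z i j = tent A z' i j"
  using assms by (simp add: tent_def carrier_tensor_def)

lemma tensor_eqI:
  assumes A: "A \<in> carrier_tensor n1 n2 m" and B: "B \<in> carrier_tensor n1 n2 m"
    and eq: "\<And>z i j. i < n1 \<Longrightarrow> j < n2 \<Longrightarrow> tent A z i j = tent B z i j"
  shows "A = B"
proof (rule nth_equalityI)
  show "length A = length B"
    using A B by (simp add: carrier_tensor_def)
  fix t assume t: "t < length A"
  have "A ! t \<in> carrier_mat n1 n2" "B ! t \<in> carrier_mat n1 n2"
    using A B t by (auto simp: carrier_tensor_def)
  note dims = carrier_matD[OF this(1)] carrier_matD[OF this(2)]
  show "A ! t = B ! t"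
  proof (rule eq_matI)
    fix i j assume "i < dim_row (B ! t)" "j < dim_col (B ! t)"
    with A B t eq[of i j "int t"] show "A ! t $$ (i, j) = B ! t $$ (i, j)"
      by (auto simp: carrier_tensor_def tent_def dims)
  qed (simp_all add: dims)
qed

lemma carrier_tensor_dims:
  assumes "A \<in> carrier_tensor n1 n2 m" "m > 0"
  shows "length A = m" "tdim_row A = n1" "tdim_col A = n2"
  using assms by (auto simp: carrier_tensor_def tdim_row_def tdim_col_def hd_conv_nth)

lemma carrier_tensor_zero: "A \<in> carrier_tensor n1 n2 0 \<longleftrightarrow> A = []"
  by (auto simp: carrier_tensor_def)

lemma tprod_carrier:
  assumes A: "A \<in> carrier_tensor n1 n2 m" and B: "B \<in> carrier_tensor n2 n3 m"
  shows "A \<star> B \<in> carrier_tensor n1 n3 m"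
proof (cases "m = 0")
  case True
  then show ?thesis
    using A by (simp add: carrier_tensor_def tprod_def tfold_def)
next
  case False
  then show ?thesis
    using carrier_tensor_dims[OF A] carrier_tensor_dims[OF B]
    by (simp add: tprod_def tfold_def carrier_tensor_def tunfold_def)
qed

lemma mult_add_less:
  fixes a i :: nat
  assumes "a < m" "i < n"
  shows "a * n + i < n * m"
proof -
  have "a * n + i < Suc a * n"
    using assms by simp
  also have "\<dots> \<le> m * n"
    using assms by (intro mult_le_mono1) simp
  finally show ?thesis
    by (simp add: mult.commute)
qed

text \<open>Block \<open>(t, u)\<close> of \<open>bcirc A\<close> is slice \<open>t - u\<close> of
  \<open>A\<close>, so multiplying by the block circulant matrix is a cyclic convolution of
  slices.\<close>

lemma tent_tprod:
  assumes A: "A \<in> carrier_tensor n1 n2 m" and B: "B \<in> carrier_tensor n2 n3 m"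
    and m: "m > 0" and i: "i < n1" and j: "j < n3"
  shows "tent (A \<star> B) z i j = (\<Sum>u\<in>{0..<int m}. \<Sum>k<n2. tent A (z - u) i k * tent B u k j)"
proof -
  define t where "t = nat (z mod int m)"
  have t: "t < m" and tz: "int t = z mod int m"
    using m by (auto simp: t_def nat_less_iff)
  note dimsA = carrier_tensor_dims[OF A m] and dimsB = carrier_tensor_dims[OF B m]
  have bound: "u * n2 + k < n2 * m" if "u < m" "k < n2" for u k
    using that by (rule mult_add_less)
  have bound': "t * n1 + i < n1 * m"
    using t i by (rule mult_add_less)
  have "tent (A \<star> B) z i j = (bcirc A * tunfold B) $$ (t * n1 + i, j)"
    using tprod_carrier[OF A B] t i j dimsA dimsB
    by (simp add: tent_def t_def tprod_def tfold_def tunfold_def)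
  also have "\<dots> = (\<Sum>l<n2 * m. bcirc A $$ (t * n1 + i, l) * tunfold B $$ (l, j))"
    using bound' j dimsA dimsB
    by (simp add: scalar_prod_def bcirc_def tunfold_def Let_def lessThan_atLeast0)
  \<comment> \<open>The inner index is cut into \<open>m\<close> blocks of length \<open>n2\<close>,
    one for each slice of \<open>B\<close>.\<close>
  also have "\<dots> = (\<Sum>u<m. \<Sum>l\<in>{u * n2..<u * n2 + n2}. bcirc A $$ (t * n1 + i, l) * tunfold B $$ (l, j))"
    by (simp add: sum.nat_group mult.commute)
  also have "\<dots> = (\<Sum>u<m. \<Sum>k<n2. bcirc A $$ (t * n1 + i, u * n2 + k) * tunfold B $$ (u * n2 + k, j))"
  proof (rule sum.cong[OF refl])
    fix u
    show "(\<Sum>l\<in>{u * n2..<u * n2 + n2}. bcirc A $$ (t * n1 + i, l) * tunfold B $$ (l, j))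
        = (\<Sum>k<n2. bcirc A $$ (t * n1 + i, u * n2 + k) * tunfold B $$ (u * n2 + k, j))"
      by (rule sum.reindex_bij_witness[where i = "\<lambda>k. u * n2 + k" and j = "\<lambda>l. l - u * n2"]) auto
  qed
  also have "\<dots> = (\<Sum>u<m. \<Sum>k<n2. tent A (z - int u) i k * tent B (int u) k j)"
  proof (intro sum.cong refl)
    fix u k assume "u \<in> {..<m}" "k \<in> {..<n2}"
    then have u: "u < m" and k: "k < n2" by auto
    \<comment> \<open>Because \<open>u < m\<close>, the natural number subtraction in
      \<open>bcirc\<close> does not truncate.\<close>
    have "int ((t + m - u) mod m) = (int t - int u + int m) mod int m"
      using u by (simp add: of_nat_mod algebra_simps)
    also have "\<dots> = (z - int u) mod int m"
      by (simp only: mod_add_self2 tz mod_diff_left_eq)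
    finally have idx: "(t + m - u) mod m = nat ((z - int u) mod int m)"
      by linarith
    have "bcirc A $$ (t * n1 + i, u * n2 + k) = tent A (z - int u) i k"
      using bound' bound[OF u k] i k dimsA by (simp add: bcirc_def Let_def tent_def idx)
    moreover have "tunfold B $$ (u * n2 + k, j) = tent B (int u) k j"
      using bound[OF u k] u k j dimsB by (simp add: tunfold_def Let_def tent_def)
    ultimately show "bcirc A $$ (t * n1 + i, u * n2 + k) * tunfold B $$ (u * n2 + k, j)
        = tent A (z - int u) i k * tent B (int u) k j"
      by simp
  qed
  also have "\<dots> = (\<Sum>u\<in>{0..<int m}. \<Sum>k<n2. tent A (z - u) i k * tent B u k j)"
    by (rule sum.reindex_bij_witness[where i = nat and j = int]) auto
  finally show ?thesis .
qed

lemma tident_carrier [simp]: "tident n m \<in> carrier_tensor n n m"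
  by (simp add: tident_def carrier_tensor_def)

lemma tent_tident:
  assumes "m > 0" "i < n" "j < n"
  shows "tent (tident n m) z i j = (if int m dvd z \<and> i = j then 1 else 0)"
proof -
  have "nat (z mod int m) < m"
    using assms by (simp add: nat_less_iff)
  moreover have "nat (z mod int m) = 0 \<longleftrightarrow> int m dvd z"
    using assms by (auto simp: dvd_eq_mod_eq_0 nat_eq_iff)
  ultimately show ?thesis
    using assms by (simp add: tent_def tident_def)
qed

lemma qmat_adjoint_carrier: "A \<in> carrier_mat n1 n2 \<Longrightarrow> qmat_adjoint A \<in> carrier_mat n2 n1"
  by (simp add: qmat_adjoint_def)

lemma length_tadjoint [simp]: "length (tadjoint A) = length A"
  by (cases A) auto

text \<open>Reversing all slices but the first negates the index modulo the length; the
  \<open>mod\<close> keeps \<open>t = 0\<close> fixed.\<close>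

lemma nth_tadjoint:
  assumes "t < length A"
  shows "tadjoint A ! t = qmat_adjoint (A ! ((length A - t) mod length A))"
proof (cases A)
  case (Cons X Xs)
  show ?thesis
  proof (cases t)
    case (Suc s)
    then show ?thesis
      using assms Cons by (simp add: rev_nth nth_Cons')
  qed (simp add: Cons)
qed (use assms in simp)

lemma tadjoint_carrier:
  assumes "A \<in> carrier_tensor n1 n2 m"
  shows "tadjoint A \<in> carrier_tensor n2 n1 m"
proof -
  have "tadjoint A ! t \<in> carrier_mat n2 n1" if "t < m" for t
  proof -
    have "(m - t) mod m < m"
      using that by simp
    then show ?thesis
      using assms that by (simp add: carrier_tensor_def nth_tadjoint qmat_adjoint_carrier)
  qed
  then show ?thesis
    using assms by (simp add: carrier_tensor_def)
qed

lemma tent_tadjoint: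
  assumes A: "A \<in> carrier_tensor n1 n2 m" and m: "m > 0" and ij: "i < n2" "j < n1"
  shows "tent (tadjoint A) z i j = qcnj (tent A (- z) j i)"
proof -
  define t where "t = nat (z mod int m)"
  have t: "t < m" and tz: "int t = z mod int m"
    using m by (auto simp: t_def nat_less_iff)
  have len: "length A = m"
    using A by (simp add: carrier_tensor_def)
  have "int ((m - t) mod m) = (- z) mod int m"
    using t by (simp add: of_nat_mod) (simp add: tz mod_simps)
  then have idx: "(m - t) mod m = nat (- z mod int m)"
    by linarith
  then have "nat (- z mod int m) < m"
    using m by (metis mod_less_divisor)
  then have "A ! nat (- z mod int m) \<in> carrier_mat n1 n2"
    using A by (simp add: carrier_tensor_def)
  then show ?thesis
    using t len ij by (simp add: tent_def nth_tadjoint idx qmat_adjoint_def flip: t_def)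
qed

subsection \<open>The algebra of the t-product\<close>

lemma tprod_assoc:
  assumes A: "A \<in> carrier_tensor n1 n2 m" and B: "B \<in> carrier_tensor n2 n3 m"
    and C: "C \<in> carrier_tensor n3 n4 m"
  shows "A \<star> B \<star> C = A \<star> (B \<star> C)"
proof (cases "m = 0")
  \<comment> \<open>The dimensions of an empty tensor are unspecified, so \<open>m = 0\<close> is
    evaluated directly.\<close>
  case True
  then show ?thesis
    using A by (simp add: carrier_tensor_zero tprod_def tfold_def)
next
  case False
  then have m: "m > 0" by simp
  note AB = tprod_carrier[OF A B] and BC = tprod_carrier[OF B C]
  show ?thesis
  proof (rule tensor_eqI[OF tprod_carrier[OF AB C] tprod_carrier[OF A BC]])
    fix z i j assume i: "i < n1" and j: "j < n4"
    let ?J = "{0..<int m}"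
    \<comment> \<open>Translating \<open>v\<close> by \<open>u\<close> moves the dependence on
      \<open>u\<close> from \<open>A\<close> to \<open>B\<close>. What then remains is
      distributivity and interchange of sums.\<close>
    have shift: "(\<Sum>v\<in>?J. \<Sum>l<n2. tent A (z - u - v) i l * tent B v l k)
        = (\<Sum>v\<in>?J. \<Sum>l<n2. tent A (z - v) i l * tent B (v - u) l k)" for u k
    proof -
      have "(\<Sum>v\<in>?J. \<Sum>l<n2. tent A (z - (v + u)) i l * tent B (v + u - u) l k)
          = (\<Sum>v\<in>?J. \<Sum>l<n2. tent A (z - v) i l * tent B (v - u) l k)"
        by (intro sum_periodic_shift[OF m] sum.cong refl arg_cong2[where f = "(*)"]
            tent_cong[OF A] tent_cong[OF B]) (simp_all add: mod_simps)
      then show ?thesis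
        by (simp add: algebra_simps)
    qed
    have "tent (A \<star> B \<star> C) z i j = (\<Sum>u\<in>?J. \<Sum>k<n3. tent (A \<star> B) (z - u) i k * tent C u k j)"
      by (rule tent_tprod[OF AB C m i j])
    also have "\<dots> = (\<Sum>u\<in>?J. \<Sum>k<n3. (\<Sum>v\<in>?J. \<Sum>l<n2. tent A (z - u - v) i l * tent B v l k) * tent C u k j)"
      by (intro sum.cong refl) (simp add: tent_tprod[OF A B m i])
    also have "\<dots> = (\<Sum>u\<in>?J. \<Sum>k<n3. (\<Sum>v\<in>?J. \<Sum>l<n2. tent A (z - v) i l * tent B (v - u) l k) * tent C u k j)"
      by (simp only: shift)
    also have "\<dots> = (\<Sum>u\<in>?J. \<Sum>v\<in>?J. \<Sum>k<n3. \<Sum>l<n2. tent A (z - v) i l * tent B (v - u) l k * tent C u k j)"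
      by (intro sum.cong refl) (simp add: sum_distrib_right sum.swap[of _ ?J "{..<n3}"])
    also have "\<dots> = (\<Sum>v\<in>?J. \<Sum>u\<in>?J. \<Sum>l<n2. \<Sum>k<n3. tent A (z - v) i l * tent B (v - u) l k * tent C u k j)"
      by (subst sum.swap) (simp add: sum.swap[of _ "{..<n3}"])
    also have "\<dots> = (\<Sum>v\<in>?J. \<Sum>l<n2. tent A (z - v) i l * tent (B \<star> C) v l j)"
      by (intro sum.cong refl)
        (simp add: tent_tprod[OF B C m _ j] sum_distrib_left mult.assoc sum.swap[of _ ?J "{..<n2}"])
    also have "\<dots> = tent (A \<star> (B \<star> C)) z i j"
      by (rule tent_tprod[OF A BC m i j, symmetric])
    finally show "tent (A \<star> B \<star> C) z i j = tent (A \<star> (B \<star> C)) z i j" .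
  qed
qed

lemma tprod_tident_left:
  fixes A :: "'a::semiring_1 tensor"
  assumes A: "A \<in> carrier_tensor n1 n2 m"
  shows "tident n1 m \<star> A = A"
proof (cases "m = 0")
  case True
  then show ?thesis
    using A by (simp add: carrier_tensor_zero tprod_def tfold_def tident_def)
next
  case False
  then have m: "m > 0" by simp
  show ?thesis
  proof (rule tensor_eqI[OF tprod_carrier[OF tident_carrier A] A])
    fix z i j assume i: "i < n1" and j: "j < n2"
    have "tent (tident n1 m \<star> A) z i j
        = (\<Sum>u\<in>{0..<int m}. \<Sum>k<n1. tent (tident n1 m) (z - u) i k * tent A u k j)"
      by (rule tent_tprod[OF tident_carrier A m i j])
    also have "\<dots> = (\<Sum>u\<in>{0..<int m}. \<Sum>k<n1. if i = k then if int m dvd z - u then tent A u k j else 0 else 0)"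
      using i by (intro sum.cong refl) (auto simp: tent_tident[OF m])
    also have "\<dots> = tent A z i j"
      using i by (simp add: sum_over_residue[OF m] tent_mod[OF A])
    finally show "tent (tident n1 m \<star> A) z i j = tent A z i j" .
  qed
qed

lemma tadjoint_tadjoint:
  assumes A: "A \<in> carrier_tensor n1 n2 m"
  shows "tadjoint (tadjoint A) = A"
proof (cases "m = 0")
  case True
  then show ?thesis
    using A by (simp add: carrier_tensor_zero)
next
  case False
  then show ?thesis
    by (intro tensor_eqI[OF tadjoint_carrier[OF tadjoint_carrier[OF A]] A])
      (simp add: tent_tadjoint[OF tadjoint_carrier[OF A]] tent_tadjoint[OF A])
qed

lemma tadjoint_tident: "tadjoint (tident n m) = tident n m"
proof (cases "m = 0")
  case True
  then show ?thesis
    by (simp add: tident_def)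
next
  case False
  then show ?thesis
    by (intro tensor_eqI[OF tadjoint_carrier[OF tident_carrier] tident_carrier])
      (simp add: tent_tadjoint[OF tident_carrier] tent_tident)
qed

text \<open>The factors change places because \<open>qcnj\<close> is antimultiplicative; the slice
  indices agree after a translation of the summation variable.\<close>

lemma tadjoint_tprod:
  assumes A: "A \<in> carrier_tensor n1 n2 m" and B: "B \<in> carrier_tensor n2 n3 m"
  shows "tadjoint (A \<star> B) = tadjoint B \<star> tadjoint A"
proof (cases "m = 0")
  case True
  then show ?thesis
    using A B by (simp add: carrier_tensor_zero tprod_def tfold_def)
next
  case False
  then have m: "m > 0" by simp
  note AB = tprod_carrier[OF A B] and A' = tadjoint_carrier[OF A] and B' = tadjoint_carrier[OF B]
  show ?thesis
  proof (rule tensor_eqI[OF tadjoint_carrier[OF AB] tprod_carrier[OF B' A']])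
    fix z i j assume i: "i < n3" and j: "j < n1"
    have minus_swap: "- a - b = - b - a" for a b :: int
      by simp
    \<comment> \<open>Expanding the left side gives \<open>?f (u + z)\<close>, and \<open>?f\<close>
      itself is the summand for the product of the adjoints.\<close>
    let ?f = "\<lambda>u. \<Sum>k<n2. qcnj (tent B (u - z) k i) * qcnj (tent A (- u) j k)"
    have "tent (tadjoint (A \<star> B)) z i j = (\<Sum>u\<in>{0..<int m}. ?f (u + z))"
      by (simp add: tent_tadjoint[OF AB m i j] tent_tprod[OF A B m j i] qcnj_sum qcnj_mult minus_swap)
    also have "\<dots> = (\<Sum>u\<in>{0..<int m}. ?f u)"
      by (intro sum_periodic_shift[OF m] sum.cong refl arg_cong2[where f = "(*)"]
          arg_cong[where f = qcnj] tent_cong[OF A] tent_cong[OF B]) (simp_all add: mod_simps)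
    also have "\<dots> = (\<Sum>u\<in>{0..<int m}. \<Sum>k<n2. tent (tadjoint B) (z - u) i k * tent (tadjoint A) u k j)"
      using i j by (simp add: tent_tadjoint[OF A m] tent_tadjoint[OF B m])
    also have "\<dots> = tent (tadjoint B \<star> tadjoint A) z i j"
      by (rule tent_tprod[OF B' A' m i j, symmetric])
    finally show "tent (tadjoint (A \<star> B)) z i j = tent (tadjoint B \<star> tadjoint A) z i j" .
  qed
qed

text \<open>Adjoints exchange the two sides, which reduces this to the left identity law for
  \<open>tadjoint A\<close>.\<close>

lemma tprod_tident_right:
  fixes A :: "quat tensor"
  assumes A: "A \<in> carrier_tensor n1 n2 m"
  shows "A \<star> tident n2 m = A"
proof -
  have "tadjoint (A \<star> tident n2 m) = tadjoint A"
    by (simp add: tadjoint_tprod[OF A tident_carrier] tadjoint_tident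
        tprod_tident_left[OF tadjoint_carrier[OF A]])
  then show ?thesis
    by (metis A tadjoint_tadjoint tident_carrier tprod_carrier)
qed

lemma tunitary_tadjoint:
  assumes "tunitary n m Q"
  shows "tunitary n m (tadjoint Q)"
proof -
  have Q: "Q \<in> carrier_tensor n n m"
    using assms by (simp add: tunitary_def)
  show ?thesis
    using assms tadjoint_carrier[OF Q] by (simp add: tunitary_def tadjoint_tadjoint[OF Q])
qed

lemma tunitary_tident: "tunitary n m (tident n m)"
  by (simp add: tunitary_def tadjoint_tident tprod_tident_left[OF tident_carrier])

lemma tunitary_tprod:
  assumes P: "tunitary n m P" and Q: "tunitary n m Q"
  shows "tunitary n m (P \<star> Q)"
proof -
  have c: "P \<in> carrier_tensor n n m" "Q \<in> carrier_tensor n n m"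
    "tadjoint P \<in> carrier_tensor n n m" "tadjoint Q \<in> carrier_tensor n n m"
    "P \<star> Q \<in> carrier_tensor n n m"
    using P Q by (auto simp: tunitary_def intro: tadjoint_carrier tprod_carrier)
  have "tadjoint (P \<star> Q) \<star> (P \<star> Q) = tadjoint Q \<star> (tadjoint P \<star> P) \<star> Q"
    using c by (simp add: tadjoint_tprod[OF c(1,2)] tprod_assoc[of _ n n m _ n _ n] tprod_carrier[of _ n n m _ n])
  moreover have "P \<star> Q \<star> tadjoint (P \<star> Q) = P \<star> (Q \<star> tadjoint Q) \<star> tadjoint P"
    using c by (simp add: tadjoint_tprod[OF c(1,2)] tprod_assoc[of _ n n m _ n _ n] tprod_carrier[of _ n n m _ n])
  ultimately show ?thesis
    using P Q c by (simp add: tunitary_def tprod_tident_right)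
qed

subsection \<open>Compactness of the unitary tensors\<close>

text \<open>\<open>quat\<close> carries no topology here, so continuity is expressed by the four
  real coordinates.\<close>

definition qcont :: "('b::topological_space \<Rightarrow> quat) \<Rightarrow> bool" where
  "qcont F \<longleftrightarrow> continuous_on UNIV (\<lambda>x. qre (F x)) \<and> continuous_on UNIV (\<lambda>x. qim1 (F x)) \<and>
     continuous_on UNIV (\<lambda>x. qim2 (F x)) \<and> continuous_on UNIV (\<lambda>x. qim3 (F x))"

lemma qcont_const: "qcont (\<lambda>x. q)"
  by (simp add: qcont_def)

lemma qcont_qcnj: "qcont F \<Longrightarrow> qcont (\<lambda>x. qcnj (F x))"
  by (auto simp: qcont_def intro!: continuous_intros)

lemma qcont_add: "qcont F \<Longrightarrow> qcont G \<Longrightarrow> qcont (\<lambda>x. F x + G x)"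
  by (auto simp: qcont_def intro!: continuous_intros)

lemma qcont_mult: "qcont F \<Longrightarrow> qcont G \<Longrightarrow> qcont (\<lambda>x. F x * G x)"
  by (auto simp: qcont_def times_quat_def intro!: continuous_intros)

lemma qcont_sum: "(\<And>i. i \<in> I \<Longrightarrow> qcont (F i)) \<Longrightarrow> qcont (\<lambda>x. \<Sum>i\<in>I. F i x)"
  by (induction I rule: infinite_finite_induct) (auto intro: qcont_const qcont_add)

definition tcont :: "nat \<Rightarrow> nat \<Rightarrow> nat \<Rightarrow> ('b::topological_space \<Rightarrow> quat tensor) \<Rightarrow> bool" where
  "tcont n1 n2 m F \<longleftrightarrow> (\<forall>x. F x \<in> carrier_tensor n1 n2 m) \<and>
     (\<forall>z. \<forall>i<n1. \<forall>j<n2. qcont (\<lambda>x. tent (F x) z i j))"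

lemma tcont_const: "A \<in> carrier_tensor n1 n2 m \<Longrightarrow> tcont n1 n2 m (\<lambda>x. A)"
  by (simp add: tcont_def qcont_const)

lemma tcont_tadjoint:
  assumes "m > 0" "tcont n1 n2 m F"
  shows "tcont n2 n1 m (\<lambda>x. tadjoint (F x))"
proof -
  have F: "F x \<in> carrier_tensor n1 n2 m" for x
    using assms by (simp add: tcont_def)
  show ?thesis
    using assms by (simp add: tcont_def tadjoint_carrier tent_tadjoint[OF F] qcont_qcnj)
qed

lemma tcont_tprod:
  assumes m: "m > 0" and "tcont n1 n2 m F" "tcont n2 n3 m G"
  shows "tcont n1 n3 m (\<lambda>x. F x \<star> G x)"
proof -
  have F: "F x \<in> carrier_tensor n1 n2 m" and G: "G x \<in> carrier_tensor n2 n3 m" for x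
    using assms by (auto simp: tcont_def)
  show ?thesis
    unfolding tcont_def
  proof (intro conjI allI impI)
    fix z i j assume i: "i < n1" and j: "j < n3"
    then show "qcont (\<lambda>x. tent (F x \<star> G x) z i j)"
      using assms by (auto simp: tent_tprod[OF F G m i j] tcont_def intro!: qcont_sum qcont_mult)
  qed (rule tprod_carrier[OF F G])
qed

lemma tcont_closed_eq:
  assumes F: "tcont n1 n2 m F" and A: "A \<in> carrier_tensor n1 n2 m"
  shows "closed {x. F x = A}"
proof -
  have "closed {x. tent (F x) z i j = tent A z i j}" if "i < n1" "j < n2" for z i j
    using F that unfolding tcont_def qcont_def quat_eq_iff
    by (intro closed_Collect_conj closed_Collect_eq continuous_on_const) auto
  then have "closed {x. i < n1 \<longrightarrow> j < n2 \<longrightarrow> tent (F x) z i j = tent A z i j}" for z i j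
    by (cases "i < n1 \<and> j < n2") auto
  then have "closed {x. \<forall>z i j. i < n1 \<longrightarrow> j < n2 \<longrightarrow> tent (F x) z i j = tent A z i j}"
    by (intro closed_Collect_all)
  moreover have "(\<forall>z i j. i < n1 \<longrightarrow> j < n2 \<longrightarrow> tent (F x) z i j = tent A z i j) \<longleftrightarrow> F x = A" for x
    using F A by (auto simp: tcont_def intro: tensor_eqI)
  ultimately show ?thesis
    by simp
qed

lemma closed_tunitary:
  assumes "m > 0" and F: "tcont n n m F"
  shows "closed {x. tunitary n m (F x)}"
proof -
  have "closed {x. tadjoint (F x) \<star> F x = tident n m}" "closed {x. F x \<star> tadjoint (F x) = tident n m}"
    using assms by (auto intro!: tcont_closed_eq tcont_tprod tcont_tadjoint)
  then show ?thesis
    using F by (simp add: tunitary_def tcont_def closed_Collect_conj)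
qed

definition qcomp :: "nat \<Rightarrow> quat \<Rightarrow> real" where
  "qcomp c q = (if c = 0 then qre q else if c = 1 then qim1 q else if c = 2 then qim2 q else qim3 q)"

text \<open>In slice \<open>0\<close> of \<open>tadjoint Q \<star> Q\<close>, the diagonal entry
  \<open>(j, j)\<close> sums the squared moduli of column \<open>j\<close> over all slices. It
  equals \<open>1\<close>, so no coordinate exceeds \<open>1\<close> in absolute value.\<close>

lemma tunitary_entry_bound:
  assumes Q: "tunitary n m Q" and m: "m > 0" and i: "i < n" and j: "j < n"
  shows "\<bar>qcomp c (tent Q z i j)\<bar> \<le> 1"
proof -
  have c: "Q \<in> carrier_tensor n n m" and eq: "tadjoint Q \<star> Q = tident n m"
    using Q by (auto simp: tunitary_def)
  let ?g = "\<lambda>u k. qre (qcnj (tent Q u k j) * tent Q u k j)"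
  let ?u = "z mod int m"
  have nonneg: "?g u k \<ge> 0" for u k
    by (simp add: qre_qcnj_mult_self)
  have "(qcomp c (tent Q z i j))\<^sup>2 \<le> ?g ?u i"
    by (auto simp: qre_qcnj_mult_self tent_mod[OF c] qcomp_def add_nonneg_nonneg)
  also have "\<dots> \<le> (\<Sum>k<n. ?g ?u k)"
    using i nonneg by (intro member_le_sum) auto
  also have "\<dots> \<le> (\<Sum>u\<in>{0..<int m}. \<Sum>k<n. ?g u k)"
    using m nonneg by (intro member_le_sum[of ?u _ "\<lambda>u. \<Sum>k<n. ?g u k"]) (auto intro: sum_nonneg)
  also have "\<dots> = qre (tent (tadjoint Q \<star> Q) 0 j j)"
    using j by (simp add: tent_tprod[OF tadjoint_carrier[OF c] c m j j] tent_tadjoint[OF c m] qre_sum)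
  also have "\<dots> = 1"
    using j m by (simp add: eq tent_tident)
  finally show ?thesis
    by (simp add: abs_square_le_1)
qed

text \<open>The Boolean in an index tells apart the coordinates of the two members of a pair of tensors.\<close>

definition tens_of :: "bool \<Rightarrow> nat \<Rightarrow> nat \<Rightarrow> (bool \<times> nat \<times> nat \<times> nat \<times> nat \<Rightarrow> real) \<Rightarrow> quat tensor" where
  "tens_of b n m x = tens n n m (\<lambda>z i j.
     Quat (x (b, nat z, i, j, 0)) (x (b, nat z, i, j, 1)) (x (b, nat z, i, j, 2)) (x (b, nat z, i, j, 3)))"

lemma tcont_tens_of: "m > 0 \<Longrightarrow> tcont n n m (tens_of b n m)"
  by (simp add: tcont_def tens_of_def tent_tens qcont_def)

text \<open>Tychonoff's theorem for a product of copies of \<open>{-1..1}\<close>; the function type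
  carries the product topology.\<close>

lemma compact_box: "compact {x :: 'i \<Rightarrow> real. \<forall>c. x c \<in> {-1..1}}"
proof -
  have "compactin (product_topology (\<lambda>_::'i. euclideanreal) UNIV) (PiE UNIV (\<lambda>_. {-1..1}))"
    by (simp add: compactin_PiE)
  then show ?thesis
    by (simp add: euclidean_product_topology PiE_UNIV_domain Pi_def)
qed

text \<open>Pairs of unitary tensors are parametrised by their real coordinates. The parameters
  giving unitary pairs form a closed subset of a compact cube, and every unitary pair has a
  parameter there.\<close>

lemma tunitary_pair_attains_sup:
  fixes f :: "quat tensor \<Rightarrow> quat tensor \<Rightarrow> real"
  assumes m: "m > 0"
    and f: "continuous_on UNIV (\<lambda>x. f (tens_of True n1 m x) (tens_of False n2 m x))"
  obtains U V where "tunitary n1 m U" "tunitary n2 m V"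
    "\<And>U' V'. tunitary n1 m U' \<Longrightarrow> tunitary n2 m V' \<Longrightarrow> f U' V' \<le> f U V"
proof -
  define K where "K = {x. \<forall>c. x c \<in> {-1..1::real}} \<inter>
    ({x. tunitary n1 m (tens_of True n1 m x)} \<inter> {x. tunitary n2 m (tens_of False n2 m x)})"
  have "compact K"
    unfolding K_def using m
    by (intro compact_Int_closed compact_box closed_Int closed_tunitary tcont_tens_of) auto
  have param: "\<exists>x\<in>K. tens_of True n1 m x = U \<and> tens_of False n2 m x = V"
    if U: "tunitary n1 m U" and V: "tunitary n2 m V" for U V
  proof -
    \<comment> \<open>Matrix entries out of range are unspecified, so their coordinates are set to
      \<open>0\<close> to stay in the cube. Slice indices beyond \<open>m\<close> are harmless,
      since \<open>tent\<close> is periodic.\<close>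
    define x where "x = (\<lambda>(b, t, i, j, c).
      if i < (if b then n1 else n2) \<and> j < (if b then n1 else n2)
      then qcomp c (tent (if b then U else V) (int t) i j) else 0)"
    have c: "U \<in> carrier_tensor n1 n1 m" "V \<in> carrier_tensor n2 n2 m"
      using U V by (auto simp: tunitary_def)
    have "tens_of True n1 m x = U"
      by (rule tensor_eqI[OF _ c(1)])
        (auto simp: tens_of_def tent_tens m x_def qcomp_def quat_eq_iff tent_mod[OF c(1)])
    moreover have "tens_of False n2 m x = V"
      by (rule tensor_eqI[OF _ c(2)])
        (auto simp: tens_of_def tent_tens m x_def qcomp_def quat_eq_iff tent_mod[OF c(2)])
    moreover have "\<bar>x k\<bar> \<le> 1" for k
      using tunitary_entry_bound[OF U m] tunitary_entry_bound[OF V m]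
      by (auto simp: x_def split: prod.split)
    then have "\<forall>k. x k \<in> {-1..1}"
      by (auto simp: abs_le_iff minus_le_iff)
    ultimately show ?thesis
      using U V by (intro bexI[of _ x]) (auto simp: K_def)
  qed
  have "K \<noteq> {}"
    using param[OF tunitary_tident tunitary_tident] by blast
  then obtain x where "x \<in> K"
    and max: "\<And>y. y \<in> K \<Longrightarrow> f (tens_of True n1 m y) (tens_of False n2 m y)
      \<le> f (tens_of True n1 m x) (tens_of False n2 m x)"
    using continuous_attains_sup[OF \<open>compact K\<close> _ continuous_on_subset[OF f]] by blast
  show thesis
  proof (rule that)
    show "tunitary n1 m (tens_of True n1 m x)" "tunitary n2 m (tens_of False n2 m x)"
      using \<open>x \<in> K\<close> by (auto simp: K_def)
    show "f U' V' \<le> f (tens_of True n1 m x) (tens_of False n2 m x)"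
      if "tunitary n1 m U'" "tunitary n2 m V'" for U' V'
      using param[OF that] max by blast
  qed
qed

subsection \<open>Plane rotations and stationarity\<close>

text \<open>A rotation in the plane of coordinates \<open>s\<close> and \<open>p\<close> with cosine
  \<open>c\<close> and sine \<open>d\<close>. Its off-diagonal phase is \<open>q\<close> in slice
  \<open>w\<close>, and minus its conjugate in slice \<open>- w\<close>, both modulo
  \<open>m\<close>.\<close>

definition givens :: "nat \<Rightarrow> nat \<Rightarrow> nat \<Rightarrow> nat \<Rightarrow> int \<Rightarrow> quat \<Rightarrow> real \<Rightarrow> real \<Rightarrow> quat tensor" where
  "givens n m s p w q c d = tens n n m (\<lambda>z i k.
     if i = s \<and> k = p then (if int m dvd z - w then d *\<^sub>R q else 0)
     else if i = p \<and> k = s then (if int m dvd z + w then - d *\<^sub>R qcnj q else 0)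
     else if i = k \<and> int m dvd z then (if i = s \<or> i = p then c *\<^sub>R 1 else 1) else 0)"

lemma givens_carrier: "givens n m s p w q c d \<in> carrier_tensor n n m"
  by (simp add: givens_def)

lemma tent_givens:
  assumes "m > 0" "i < n" "k < n"
  shows "tent (givens n m s p w q c d) z i k =
    (if i = s \<and> k = p then (if int m dvd z - w then d *\<^sub>R q else 0)
     else if i = p \<and> k = s then (if int m dvd z + w then - d *\<^sub>R qcnj q else 0)
     else if i = k \<and> int m dvd z then (if i = s \<or> i = p then c *\<^sub>R 1 else 1) else 0)"
  using assms by (simp add: givens_def tent_tens dvd_eq_mod_eq_0 mod_simps)

text \<open>Each row of the rotation has at most two nonzero entries over all slices, so the
  convolution reduces to at most two terms. Slice \<open>w\<close> of the phase appears as a cyclic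
  shift by \<open>w\<close>.\<close>

lemma tent_givens_tprod:
  assumes M: "M \<in> carrier_tensor n n' m" and m: "m > 0" and i: "i < n" and j: "j < n'"
    and sp: "s < n" "p < n" "s \<noteq> p"
  shows "tent (givens n m s p w q c d \<star> M) z i j =
    (if i = s then c *\<^sub>R tent M z s j + d *\<^sub>R (q * tent M (z - w) p j)
     else if i = p then c *\<^sub>R tent M z p j - d *\<^sub>R (qcnj q * tent M (z + w) s j)
     else tent M z i j)"
proof -
  let ?J = "{0..<int m}"
  have sum: "(\<Sum>u\<in>?J. \<Sum>k<n. (if k = a then if int m dvd y - u then f u else 0 else 0)
      + (if k = b then if int m dvd x - u then g u else 0 else 0)) = f (y mod int m) + g (x mod int m)"
    if "a < n" "b < n" for a b x y and f g :: "int \<Rightarrow> quat"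
    using that by (simp add: sum.distrib sum_over_residue[OF m])
  have "tent (givens n m s p w q c d \<star> M) z i j
      = (\<Sum>u\<in>?J. \<Sum>k<n. tent (givens n m s p w q c d) (z - u) i k * tent M u k j)"
    by (rule tent_tprod[OF givens_carrier M m i j])
  also have "\<dots> = (if i = s then c *\<^sub>R tent M z s j + d *\<^sub>R (q * tent M (z - w) p j)
     else if i = p then c *\<^sub>R tent M z p j - d *\<^sub>R (qcnj q * tent M (z + w) s j)
     else tent M z i j)"
  proof -
    consider "i = s" | "i = p" | "i \<noteq> s" "i \<noteq> p"
      by blast
    then show ?thesis
    proof cases
      case 1
      have "(\<Sum>u\<in>?J. \<Sum>k<n. tent (givens n m s p w q c d) (z - u) i k * tent M u k j)
        = (\<Sum>u\<in>?J. \<Sum>k<n. (if k = s then if int m dvd z - u then c *\<^sub>R tent M u s j else 0 else 0)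
        + (if k = p then if int m dvd z - w - u then d *\<^sub>R (q * tent M u p j) else 0 else 0))"
        using sp i 1 by (intro sum.cong refl) (auto simp: tent_givens[OF m] algebra_simps)
      then show ?thesis
        unfolding sum[OF sp(1,2)] using 1 by (simp add: tent_mod[OF M])
    next
      case 2
      have "(\<Sum>u\<in>?J. \<Sum>k<n. tent (givens n m s p w q c d) (z - u) i k * tent M u k j)
        = (\<Sum>u\<in>?J. \<Sum>k<n. (if k = p then if int m dvd z - u then c *\<^sub>R tent M u p j else 0 else 0)
        + (if k = s then if int m dvd z + w - u then - d *\<^sub>R (qcnj q * tent M u s j) else 0 else 0))"
        using sp i 2 by (intro sum.cong refl) (auto simp: tent_givens[OF m] algebra_simps)
      then show ?thesis
        unfolding sum[OF sp(2,1)] using 2 sp by (simp add: tent_mod[OF M])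
    next
      \<comment> \<open>Only one term occurs here; a vanishing second one is added to fit the
        pattern of \<open>sum\<close>.\<close>
      case 3
      have "(\<Sum>u\<in>?J. \<Sum>k<n. tent (givens n m s p w q c d) (z - u) i k * tent M u k j)
        = (\<Sum>u\<in>?J. \<Sum>k<n. (if k = i then if int m dvd z - u then tent M u i j else 0 else 0)
        + (if k = s then if int m dvd z - u then 0 else 0 else 0))"
        using sp i 3 by (intro sum.cong refl) (auto simp: tent_givens[OF m])
      then show ?thesis
        unfolding sum[OF i sp(1)] using 3 by (simp add: tent_mod[OF M])
    qed
  qed
  finally show ?thesis .
qed

text \<open>The adjoint of a rotation is the rotation by the opposite angle, with the same
  phase.\<close>

lemma tadjoint_givens:
  assumes "m > 0" "s \<noteq> p"
  shows "tadjoint (givens n m s p w q c d) = givens n m s p w q c (- d)"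
proof (rule tensor_eqI[OF tadjoint_carrier[OF givens_carrier] givens_carrier])
  fix z i j assume ij: "i < n" "j < n"
  have "int m dvd - z - w \<longleftrightarrow> int m dvd z + w" "int m dvd - z + w \<longleftrightarrow> int m dvd z - w"
    using dvd_minus_iff[of "int m" "z + w"] dvd_minus_iff[of "int m" "z - w"] by simp_all
  then show "tent (tadjoint (givens n m s p w q c d)) z i j = tent (givens n m s p w q c (- d)) z i j"
    using assms ij by (auto simp: tent_tadjoint[OF givens_carrier] tent_givens quat_eq_iff)
qed

lemma givens_tprod_givens:
  assumes m: "m > 0" and sp: "s < n" "p < n" "s \<noteq> p"
    and q: "q * qcnj q = 1" "qcnj q * q = 1" and cd: "c\<^sup>2 + d\<^sup>2 = 1"
  shows "givens n m s p w q c d \<star> givens n m s p w q c (- d) = tident n m"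
proof (rule tensor_eqI[OF tprod_carrier[OF givens_carrier givens_carrier] tident_carrier])
  fix z i j assume i: "i < n" and j: "j < n"
  have "c *\<^sub>R c *\<^sub>R x + d *\<^sub>R d *\<^sub>R x = x" for x :: quat
    using cd by (simp add: power2_eq_square flip: scaleR_left.add)
  then show "tent (givens n m s p w q c d \<star> givens n m s p w q c (- d)) z i j = tent (tident n m) z i j"
    using sp i j
    by (auto simp: tent_givens_tprod[OF givens_carrier m i j sp] tent_givens[OF m] tent_tident[OF m] q)
qed

lemma tunitary_givens:
  assumes "m > 0" "s < n" "p < n" "s \<noteq> p" "q * qcnj q = 1" "qcnj q * q = 1" "c\<^sup>2 + d\<^sup>2 = 1"
  shows "tunitary n m (givens n m s p w q c d)"
  using givens_tprod_givens[OF assms, of w] givens_tprod_givens[OF assms(1-6), of c "- d" w] assms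
  by (simp add: tunitary_def givens_carrier tadjoint_givens)

text \<open>On the unit circle the linear form attains \<open>sqrt (a\<^sup>2 + b\<^sup>2)\<close>,
  in the direction of \<open>(a, b)\<close>. This exceeds \<open>a\<close> unless
  \<open>b = 0\<close>.\<close>

lemma circle_max_imp_zero:
  fixes a b :: real
  assumes "\<And>c d. c\<^sup>2 + d\<^sup>2 = 1 \<Longrightarrow> c * a + d * b \<le> a"
  shows "b = 0"
proof (rule ccontr)
  assume b: "b \<noteq> 0"
  define r where "r = sqrt (a\<^sup>2 + b\<^sup>2)"
  have r2: "r\<^sup>2 = a\<^sup>2 + b\<^sup>2"
    by (simp add: r_def)
  have "r > 0"
    using b by (simp add: r_def sum_power2_gt_zero_iff)
  moreover have "r > a"
    using b unfolding r_def by (intro real_less_rsqrt) simp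
  ultimately have r: "r > 0" "r > a" .
  have "(a / r)\<^sup>2 + (b / r)\<^sup>2 = r\<^sup>2 / r\<^sup>2"
    by (simp only: power_divide r2 add_divide_distrib)
  then have "(a / r)\<^sup>2 + (b / r)\<^sup>2 = 1"
    using r by simp
  then have "a / r * a + b / r * b \<le> a"
    by (rule assms)
  moreover have "a / r * a + b / r * b = r\<^sup>2 / r"
    by (simp only: r2 add_divide_distrib) (simp add: power2_eq_square)
  ultimately show False
    using r by (simp add: power2_eq_square)
qed

section \<open>The weighted trace and its maximisers\<close>

definition wtrace :: "(nat \<Rightarrow> real) \<Rightarrow> nat \<Rightarrow> quat tensor \<Rightarrow> real" where
  "wtrace e r M = (\<Sum>t<r. e t * qre (tent M 0 t t))"

text \<open>Only the diagonal entries at \<open>s\<close> and \<open>p\<close> of slice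
  \<open>0\<close> change. The vanishing weights beyond \<open>r\<close> keep the formula uniform,
  even where such a diagonal entry lies outside the matrix.\<close>

lemma wtrace_givens_tprod:
  assumes M: "M \<in> carrier_tensor n1 n2 m" and m: "m > 0"
    and sp: "s < n1" "p < n1" "s \<noteq> p" and r: "r \<le> n1" "r \<le> n2" and e: "\<And>t. t \<ge> r \<Longrightarrow> e t = 0"
  shows "wtrace e r (givens n1 m s p w q c d \<star> M) = wtrace e r M
    + (c - 1) * (e s * qre (tent M 0 s s) + e p * qre (tent M 0 p p))
    + d * (e s * qre (q * tent M (- w) p s) - e p * qre (qcnj q * tent M w s p))"
proof -
  let ?s = "e s * ((c - 1) * qre (tent M 0 s s) + d * qre (q * tent M (- w) p s))"
  let ?p = "e p * ((c - 1) * qre (tent M 0 p p) - d * qre (qcnj q * tent M w s p))"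
  have "wtrace e r (givens n1 m s p w q c d \<star> M)
      = (\<Sum>t<r. e t * qre (tent M 0 t t) + (if t = s then ?s else 0) + (if t = p then ?p else 0))"
    unfolding wtrace_def
  proof (rule sum.cong[OF refl])
    fix t assume "t \<in> {..<r}"
    then have t: "t < n1" "t < n2"
      using r by auto
    show "e t * qre (tent (givens n1 m s p w q c d \<star> M) 0 t t)
      = e t * qre (tent M 0 t t) + (if t = s then ?s else 0) + (if t = p then ?p else 0)"
      using sp by (simp add: tent_givens_tprod[OF M m t sp] algebra_simps)
  qed
  also have "\<dots> = wtrace e r M + (if s < r then ?s else 0) + (if p < r then ?p else 0)"
    by (simp add: sum.distrib wtrace_def)
  also have "\<dots> = wtrace e r M + ?s + ?p"
    using e by auto
  finally show ?thesis
    by (simp add: algebra_simps)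
qed

text \<open>Among the rotations with fixed \<open>q\<close> and \<open>w\<close>, the identity
  (\<open>c = 1\<close>, \<open>d = 0\<close>) is a maximiser, so the coefficient of
  \<open>d\<close> vanishes.\<close>

lemma wtrace_stationary:
  assumes M: "M \<in> carrier_tensor n1 n2 m" and m: "m > 0"
    and sp: "s < n1" "p < n1" "s \<noteq> p" and r: "r \<le> n1" "r \<le> n2" and e: "\<And>t. t \<ge> r \<Longrightarrow> e t = 0"
    and max: "\<And>G. tunitary n1 m G \<Longrightarrow> wtrace e r (G \<star> M) \<le> wtrace e r M"
  shows "e s *\<^sub>R tent M (- w) p s = e p *\<^sub>R qcnj (tent M w s p)"
proof -
  let ?X = "tent M (- w) p s" and ?Y = "tent M w s p"
  have *: "e s * qre (q * ?X) = e p * qre (qcnj q * ?Y)" if q: "q * qcnj q = 1" "qcnj q * q = 1" for q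
  proof -
    have "e s * qre (q * ?X) - e p * qre (qcnj q * ?Y) = 0"
    proof (rule circle_max_imp_zero[of "e s * qre (tent M 0 s s) + e p * qre (tent M 0 p p)"])
      fix c d :: real assume "c\<^sup>2 + d\<^sup>2 = 1"
      from max[OF tunitary_givens[OF m sp q this], of w]
      show "c * (e s * qre (tent M 0 s s) + e p * qre (tent M 0 p p))
          + d * (e s * qre (q * ?X) - e p * qre (qcnj q * ?Y))
        \<le> e s * qre (tent M 0 s s) + e p * qre (tent M 0 p p)"
        by (simp add: wtrace_givens_tprod[where e = e, OF M m sp r e] algebra_simps)
    qed
    then show ?thesis
      by simp
  qed
  show ?thesis
    \<comment> \<open>The phases \<open>1\<close>, \<open>i\<close>, \<open>j\<close>,
      \<open>k\<close> extract the four real coordinates of the quaternion identity.\<close>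
    using *[of 1] *[of quat_i] *[of quat_j] *[of quat_k]
    by (simp add: quat_eq_iff times_quat_def quat_i_def quat_j_def quat_k_def one_quat_def qcnj_def)
qed

text \<open>Slice \<open>0\<close> is fixed by the reversal, and real parts are fixed by
  conjugation.\<close>

lemma wtrace_tadjoint:
  assumes M: "M \<in> carrier_tensor n1 n2 m" and m: "m > 0" and r: "r \<le> n1" "r \<le> n2"
  shows "wtrace e r (tadjoint M) = wtrace e r M"
  unfolding wtrace_def using r by (intro sum.cong refl) (simp add: tent_tadjoint[OF M m])

lemma tdiagonal_of_wtrace_max:
  fixes n1 n2 :: nat
  defines "r \<equiv> min n1 n2"
  defines "e \<equiv> \<lambda>t. if t < r then real (t + 1) else 0"
  assumes M: "M \<in> carrier_tensor n1 n2 m" and m: "m > 0"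
    and maxL: "\<And>G. tunitary n1 m G \<Longrightarrow> wtrace e r (G \<star> M) \<le> wtrace e r M"
    and maxR: "\<And>H. tunitary n2 m H \<Longrightarrow> wtrace e r (M \<star> H) \<le> wtrace e r M"
  shows "tdiagonal M"
proof -
  have r: "r \<le> n1" "r \<le> n2" and e0: "\<And>t. t \<ge> r \<Longrightarrow> e t = 0"
    by (auto simp: r_def e_def)
  note M' = tadjoint_carrier[OF M]
  \<comment> \<open>Column operations on \<open>M\<close> are row operations on its adjoint, so
    \<open>wtrace_stationary\<close> will serve for both sides.\<close>
  have max': "wtrace e r (H \<star> tadjoint M) \<le> wtrace e r (tadjoint M)" if H: "tunitary n2 m H" for H
  proof -
    have Hc: "H \<in> carrier_tensor n2 n2 m" and H': "tunitary n2 m (tadjoint H)"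
      using H tunitary_tadjoint by (auto simp: tunitary_def)
    have "H \<star> tadjoint M = tadjoint (M \<star> tadjoint H)"
      by (simp add: tadjoint_tprod[OF M tadjoint_carrier[OF Hc]] tadjoint_tadjoint[OF Hc])
    then show ?thesis
      using maxR[OF H'] by (simp add: wtrace_tadjoint[OF M m r]
          wtrace_tadjoint[OF tprod_carrier[OF M tadjoint_carrier[OF Hc]] m r])
  qed
  have zero: "tent M w s p = 0" if s: "s < n1" and p: "p < n2" and sp: "s \<noteq> p" for w s p
  proof -
    let ?X = "tent M (- w) p s" and ?Y = "qcnj (tent M w s p)"
    have L: "e s *\<^sub>R ?X = e p *\<^sub>R ?Y" if "p < n1"
      by (rule wtrace_stationary[where e = e, OF M m s that sp r e0 maxL])
    have R: "e s *\<^sub>R ?Y = e p *\<^sub>R ?X" if s2: "s < n2"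
    proof -
      have *: "e s *\<^sub>R tent (tadjoint M) (- w) p s = e p *\<^sub>R qcnj (tent (tadjoint M) w s p)"
        by (rule wtrace_stationary[where e = e, OF M' m s2 p sp r(2,1) e0 max'])
      have "e p *\<^sub>R qcnj (tent (tadjoint M) w s p) = e p *\<^sub>R ?X"
        \<comment> \<open>For \<open>p \<ge> n1\<close> the adjoint has no column \<open>p\<close>,
          but then \<open>e p = 0\<close> and both sides vanish.\<close>
        using tent_tadjoint[OF M m s2, of p w] by (cases "p < n1") (auto simp: e_def r_def)
      then show ?thesis
        using * tent_tadjoint[OF M m p s, of "- w"] by simp
    qed
    \<comment> \<open>An index at or beyond \<open>r\<close> must lie in the longer dimension: for
      \<open>s\<close> this forces \<open>s \<ge> n2\<close>, for \<open>p\<close> it forces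
      \<open>p \<ge> n1\<close>.\<close>
    consider "s < r" "p < r" | "s \<ge> n2" | "p \<ge> n1"
      using s p by (force simp: r_def)
    then have "?Y = 0"
    proof cases
      case 1
      \<comment> \<open>Multiplying \<open>R\<close> by \<open>e s\<close> and \<open>L\<close> by
        \<open>e p\<close> eliminates \<open>?X\<close>. The weights are positive and distinct, so
        their squares differ.\<close>
      then have "(e s * e s) *\<^sub>R ?Y = (e p * e p) *\<^sub>R ?Y"
        using L R by (metis r order_less_le_trans mult.commute scaleR_scaleR)
      moreover have "e s * e s \<noteq> e p * e p"
        using 1 sp by (auto simp: e_def simp flip: power2_eq_square)
      ultimately show ?thesis
        by auto
    next
      case 2
      \<comment> \<open>Here \<open>e s = 0\<close>, while \<open>p < r\<close> makes
        \<open>e p\<close> positive, so \<open>L\<close> alone suffices; the next case is the mirror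
        image with \<open>R\<close>.\<close>
      then show ?thesis
        using L s p by (auto simp: e_def r_def)
    next
      case 3
      then show ?thesis
        using R s p by (auto simp: e_def r_def)
    qed
    then show ?thesis
      by (metis qcnj_simps(1,3))
  qed
  show ?thesis
    unfolding tdiagonal_def diagonal_mat_def
  proof (intro allI impI)
    fix t i j assume "t < length M" "i < dim_row (M ! t)" "j < dim_col (M ! t)" "i \<noteq> j"
    then show "M ! t $$ (i, j) = 0"
      using M zero[of i j "int t"] by (auto simp: carrier_tensor_def tent_def)
  qed
qed

theorem theorem4:
  fixes T :: "quat tensor" and n1 n2 m :: nat
  assumes "T \<in> carrier_tensor n1 n2 m"
  shows "\<exists>U S V. tunitary n1 m U \<and> tunitary n2 m V \<and>
           S \<in> carrier_tensor n1 n2 m \<and> tdiagonal S \<and>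
           T = U \<star> S \<star> tadjoint V"
proof (cases "m = 0")
  case True
  then show ?thesis
    using assms
    by (intro exI[of _ "[]"]) (simp add: carrier_tensor_zero tdiagonal_def tprod_def tfold_def
        tunitary_def tident_def)
next
  case False
  then have m: "m > 0" by simp
  note T = assms
  let ?r = "min n1 n2"
  let ?e = "\<lambda>t. if t < ?r then real (t + 1) else 0"
  let ?f = "\<lambda>U V. wtrace ?e ?r (tadjoint U \<star> T \<star> V)"
  have "tcont n1 n2 m (\<lambda>x. tadjoint (tens_of True n1 m x) \<star> T \<star> tens_of False n2 m x)"
    using m T by (intro tcont_tprod tcont_tadjoint tcont_const) (auto intro: tcont_tens_of)
  then have "continuous_on UNIV (\<lambda>x. ?f (tens_of True n1 m x) (tens_of False n2 m x))"
    unfolding wtrace_def by (intro continuous_intros) (auto simp: tcont_def qcont_def)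
  then obtain U V where U: "tunitary n1 m U" and V: "tunitary n2 m V"
    and max: "\<And>U' V'. tunitary n1 m U' \<Longrightarrow> tunitary n2 m V' \<Longrightarrow> ?f U' V' \<le> ?f U V"
    by (rule tunitary_pair_attains_sup[OF m, of ?f]) blast
  have Uc: "U \<in> carrier_tensor n1 n1 m" and Vc: "V \<in> carrier_tensor n2 n2 m"
    using U V by (auto simp: tunitary_def)
  note U' = tadjoint_carrier[OF Uc] and V' = tadjoint_carrier[OF Vc]
  note UT = tprod_carrier[OF U' T]
  define S where "S = tadjoint U \<star> T \<star> V"
  have S: "S \<in> carrier_tensor n1 n2 m"
    unfolding S_def by (rule tprod_carrier[OF UT Vc])
  have "tdiagonal S"
  proof (rule tdiagonal_of_wtrace_max[OF S m])
    fix G assume G: "tunitary n1 m G"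
    then have Gc: "G \<in> carrier_tensor n1 n1 m"
      by (simp add: tunitary_def)
    \<comment> \<open>Multiplying \<open>S\<close> by \<open>G\<close> on the left amounts to
      replacing \<open>U\<close> by the unitary \<open>U \<star> tadjoint G\<close>, which competes
      in the maximum.\<close>
    have "G \<star> S = tadjoint (U \<star> tadjoint G) \<star> T \<star> V"
      unfolding S_def tadjoint_tprod[OF Uc tadjoint_carrier[OF Gc]] tadjoint_tadjoint[OF Gc]
      by (simp add: tprod_assoc[OF Gc UT Vc] tprod_assoc[OF Gc U' T])
    then show "wtrace ?e ?r (G \<star> S) \<le> wtrace ?e ?r S"
      using max[OF tunitary_tprod[OF U tunitary_tadjoint[OF G]] V] by (simp add: S_def)
  next
    fix H assume H: "tunitary n2 m H"
    then have Hc: "H \<in> carrier_tensor n2 n2 m"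
      by (simp add: tunitary_def)
    show "wtrace ?e ?r (S \<star> H) \<le> wtrace ?e ?r S"
      using max[OF U tunitary_tprod[OF V H]] by (simp add: S_def tprod_assoc[OF UT Vc Hc])
  qed
  moreover have "U \<star> S \<star> tadjoint V = T"
  proof -
    have "U \<star> S \<star> tadjoint V = U \<star> (S \<star> tadjoint V)"
      by (rule tprod_assoc[OF Uc S V'])
    also have "S \<star> tadjoint V = tadjoint U \<star> T"
      using V by (simp add: S_def tprod_assoc[OF UT Vc V'] tunitary_def tprod_tident_right[OF UT])
    also have "U \<star> (tadjoint U \<star> T) = T"
      using U by (simp add: tunitary_def tprod_tident_left[OF T] flip: tprod_assoc[OF Uc U' T])
    finally show ?thesis .
  qed
  ultimately show ?thesis
    using U V S by metis
qed

end
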